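(* Let $q$ be a prime power and let $r\geq 2$ be an integer. For each $k\in\mathbb{F}_q$, let $C_{k,r}\subset\mathbb{P}^2$ be the plane-filling curve over $\mathbb{F}_q$ defined by $$x^r (x^q y - x y^q) + y^r (y^q z - y z^q) + (z^r + k x^r)(z^q x - z x^q) = 0.$$ Then $C_{k,r}$ is smooth at every $\mathbb{F}_q$-point of $\mathbb{P}^2$ if and only if the polynomial $x^{r^2+r+1}+kx^{r+1}-1\in\mathbb{F}_q[x]$ has no zeros in $\mathbb{F}_q$.
   Context: $\mathbb{P}^2$ is the projective plane with homogeneous coordinates $[x:y:z]$. A plane curve $C=\{f=0\}\subset\mathbb{P}^2$, with $f\in\mathbb{F}_q[x,y,z]$ nonzero homogeneous, is called plane-filling if it contains every $\mathbb{F}_q$-point of $\mathbb{P}^2$, i.e. $C(\mathbb{F}_q)=\mathbb{P}^2(\mathbb{F}_q)$. The curve $C$ is singular at a point $P$ if $f$ and all three partial derivatives $\partial f/\partial x,\partial f/\partial y,\partial f/\partial z$ vanish at $P$; it is smooth at a point $P\in C$ if it is not singular there. *)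

theory Defs
  imports "HOL-Computational_Algebra.Computational_Algebra" "HOL-Library.Cardinality"
begin

text \<open>
  The ring \<open>K[x,y,z]\<close> is represented as \<open>((K[x])[y])[z]\<close>: the outermost variable is \<open>z\<close>,
  the innermost one is \<open>x\<close>.
\<close>

type_synonym 'a poly3 = "'a poly poly poly"

definition varX :: "'a::comm_ring_1 poly3" where "varX = [:[:[:0, 1:]:]:]"
definition varY :: "'a::comm_ring_1 poly3" where "varY = [:[:0, 1:]:]"
definition varZ :: "'a::comm_ring_1 poly3" where "varZ = [:0, 1:]"

definition const3 :: "'a::comm_ring_1 \<Rightarrow> 'a poly3" where "const3 c = [:[:[:c:]:]:]"

definition coeff3 :: "'a::zero poly3 \<Rightarrow> nat \<Rightarrow> nat \<Rightarrow> nat \<Rightarrow> 'a"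
  where "coeff3 f i j l = coeff (coeff (coeff f l) j) i"

fun eval3 :: "'a::comm_ring_1 poly3 \<Rightarrow> 'a \<times> 'a \<times> 'a \<Rightarrow> 'a"
  where "eval3 f (a, b, c) = poly (poly (poly f [:[:c:]:]) [:b:]) a"

definition dX :: "'a::idom poly3 \<Rightarrow> 'a poly3" where "dX = map_poly (map_poly pderiv)"
definition dY :: "'a::idom poly3 \<Rightarrow> 'a poly3" where "dY = map_poly pderiv"
definition dZ :: "'a::idom poly3 \<Rightarrow> 'a poly3" where "dZ = pderiv"

definition homogeneous3 :: "nat \<Rightarrow> 'a::zero poly3 \<Rightarrow> bool"
  where "homogeneous3 d f \<longleftrightarrow> (\<forall>i j l. coeff3 f i j l \<noteq> 0 \<longrightarrow> i + j + l = d)"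

definition proj_rel :: "(('a::field \<times> 'a \<times> 'a) \<times> ('a \<times> 'a \<times> 'a)) set"
  where "proj_rel = {((a, b, c), (a', b', c')) | a b c a' b' c'. (a, b, c) \<noteq> (0, 0, 0) \<and>
           (\<exists>t. t \<noteq> 0 \<and> a' = t * a \<and> b' = t * b \<and> c' = t * c)}"

definition proj_plane :: "('a::field \<times> 'a \<times> 'a) set set"
  where "proj_plane = (UNIV - {(0, 0, 0)}) // proj_rel"

text \<open>
  A point is the set of all its homogeneous coordinate vectors. For homogeneous polynomials,
  vanishing at one of them is the same as vanishing at all of them.
\<close>

definition vanishes_at :: "'a::field poly3 \<Rightarrow> ('a \<times> 'a \<times> 'a) set \<Rightarrow> bool"
  where "vanishes_at f P \<longleftrightarrow> (\<forall>v\<in>P. eval3 f v = 0)"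

definition rational_points :: "'a::field poly3 \<Rightarrow> ('a \<times> 'a \<times> 'a) set set"
  where "rational_points f = {P \<in> proj_plane. vanishes_at f P}"

definition plane_curve :: "'a::field poly3 \<Rightarrow> bool"
  where "plane_curve f \<longleftrightarrow> f \<noteq> 0 \<and> (\<exists>d. homogeneous3 d f)"

definition plane_filling :: "'a::field poly3 \<Rightarrow> bool"
  where "plane_filling f \<longleftrightarrow> plane_curve f \<and> rational_points f = proj_plane"

definition singular_at :: "'a::field poly3 \<Rightarrow> ('a \<times> 'a \<times> 'a) set \<Rightarrow> bool"
  where "singular_at f P \<longleftrightarrow>
    vanishes_at f P \<and> vanishes_at (dX f) P \<and> vanishes_at (dY f) P \<and> vanishes_at (dZ f) P"

definition smooth_at :: "'a::field poly3 \<Rightarrow> ('a \<times> 'a \<times> 'a) set \<Rightarrow> bool"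
  where "smooth_at f P \<longleftrightarrow> vanishes_at f P \<and> \<not> singular_at f P"

definition curve_C :: "nat \<Rightarrow> 'a::field \<Rightarrow> nat \<Rightarrow> 'a poly3"
  where "curve_C q k r =
    varX ^ r * (varX ^ q * varY - varX * varY ^ q)
    + varY ^ r * (varY ^ q * varZ - varY * varZ ^ q)
    + (varZ ^ r + const3 k * varX ^ r) * (varZ ^ q * varX - varZ * varX ^ q)"

lemma coeff3_add: "coeff3 (f + g) i j l = coeff3 f i j l + coeff3 g i j l"
  by (simp add: coeff3_def)

lemma coeff3_diff: "coeff3 (f - g) i j l = coeff3 f i j l - coeff3 g i j l"
  for f g :: "'a::comm_ring_1 poly3"
  by (simp add: coeff3_def)

lemma coeff3_monomial:
  "coeff3 (const3 c * (varX ^ i' * varY ^ j' * varZ ^ l')) i j l =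
     (if i = i' \<and> j = j' \<and> l = l' then c else 0)"
proof -
  have "varX ^ i' = [:[:monom (1 :: 'a) i':]:]"
    by (simp add: varX_def poly_const_pow monom_altdef)
  moreover have "varY ^ j' = [:monom (1 :: 'a poly) j':]"
    by (simp add: varY_def poly_const_pow monom_altdef)
  moreover have "varZ ^ l' = monom (1 :: 'a poly poly) l'"
    by (simp add: varZ_def monom_altdef)
  ultimately have "const3 c * (varX ^ i' * varY ^ j' * varZ ^ l') =
      monom (monom (monom c i') j') l'"
    by (simp add: const3_def smult_monom)
  thus ?thesis
    by (simp add: coeff3_def)
qed

lemma homogeneous3_add: "homogeneous3 d f \<Longrightarrow> homogeneous3 d g \<Longrightarrow> homogeneous3 d (f + g)"
  unfolding homogeneous3_def coeff3_add by (metis add.right_neutral)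

lemma homogeneous3_diff: "homogeneous3 d f \<Longrightarrow> homogeneous3 d g \<Longrightarrow> homogeneous3 d (f - g)"
  for f g :: "'a::comm_ring_1 poly3"
  unfolding homogeneous3_def coeff3_diff by (metis diff_zero)

lemma homogeneous3_monomial:
  "i + j + l = d \<Longrightarrow> homogeneous3 d (const3 c * (varX ^ i * varY ^ j * varZ ^ l))"
  by (simp add: homogeneous3_def coeff3_monomial)

lemma curve_C_monomials:
  fixes k :: "'a::field"
  shows "curve_C q k r =
    const3 1 * (varX ^ (r + q) * varY ^ 1 * varZ ^ 0)
    - const3 1 * (varX ^ (r + 1) * varY ^ q * varZ ^ 0)
    + const3 1 * (varX ^ 0 * varY ^ (r + q) * varZ ^ 1)
    - const3 1 * (varX ^ 0 * varY ^ (r + 1) * varZ ^ q)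
    + const3 1 * (varX ^ 1 * varY ^ 0 * varZ ^ (r + q))
    - const3 1 * (varX ^ q * varY ^ 0 * varZ ^ (r + 1))
    + const3 k * (varX ^ (r + 1) * varY ^ 0 * varZ ^ q)
    - const3 k * (varX ^ (r + q) * varY ^ 0 * varZ ^ 1)"
proof -
  have [simp]: "const3 (1 :: 'a) = 1"
    by (simp add: const3_def one_pCons)
  show ?thesis
    by (simp add: curve_C_def algebra_simps power_add)
qed

lemma plane_filling_curve_C:
  fixes k :: "'a::finite_field"
  assumes "r \<ge> 2"
  shows "plane_filling (curve_C (CARD('a)) k r)"
proof -
  let ?q = "CARD('a)"
  have q: "?q \<ge> 2"
    using card_mono[of "UNIV :: 'a set" "{0, 1}"] by simp
  have hom: "homogeneous3 (r + ?q + 1) (curve_C ?q k r)"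
    unfolding curve_C_monomials
    by (intro homogeneous3_add homogeneous3_diff homogeneous3_monomial) simp_all
  have "coeff3 (curve_C ?q k r) (r + ?q) 1 0 = 1"
    unfolding curve_C_monomials coeff3_add coeff3_diff coeff3_monomial
    using q assms by simp
  hence nz: "curve_C ?q k r \<noteq> 0"
    by (auto simp: coeff3_def)
  have "eval3 (curve_C ?q k r) v = 0" for v
    by (cases v) (simp add: curve_C_def varX_def varY_def varZ_def const3_def
        finite_field_power_card_eq_same)
  hence "rational_points (curve_C ?q k r) = proj_plane"
    by (auto simp: rational_points_def vanishes_at_def)
  with hom nz show ?thesis
    by (auto simp: plane_filling_def plane_curve_def)
qed

end

theory Submission
  imports Defs
begin

text \<open>
  Write \<open>A = x\<^sup>q y - x y\<^sup>q\<close>, \<open>B = y\<^sup>q z - y z\<^sup>q\<close>, \<open>C = z\<^sup>q x - z x\<^sup>q\<close> and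
  \<open>w = z\<^sup>r + k x\<^sup>r\<close>, so that the curve is \<open>x\<^sup>r A + y\<^sup>r B + w C = 0\<close>. At a rational point
  \<open>A\<close>, \<open>B\<close>, \<open>C\<close> vanish, so a derivation only acts on them and not on their coefficients.
  Moreover \<open>q = 0\<close> in the field, so \<open>q\<close>-th powers have derivative zero and the differential of
  \<open>A\<close> is \<open>x dy - y dx\<close>, and similarly for \<open>B\<close> and \<open>C\<close>. The gradient of the curve at
  a rational point is therefore
  \<open>(w z - x\<^sup>r y, x\<^sup>r x - y\<^sup>r z, y\<^sup>r y - w x)\<close> (lemma \<open>singular_iff_gradient_zero\<close>).

  Suppose it is zero. If \<open>y = 0\<close>, then \<open>x = 0\<close> and \<open>z = 0\<close>; so \<open>y \<noteq> 0\<close>, and with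
  \<open>t = x / y\<close> and \<open>s = z / y\<close> the equations say \<open>s = t\<^bsup>r + 1\<^esup>\<close> and
  \<open>(s\<^sup>r + k t\<^sup>r) t = 1\<close>. Eliminating \<open>s\<close> leaves the equation
  \<open>t\<^bsup>r\<^sup>2 + r + 1\<^esup> + k t\<^bsup>r + 1\<^esup> = 1\<close>. Conversely a root \<open>t\<close> gives the singular point
  \<open>[t : 1 : t\<^bsup>r + 1\<^esup>]\<close>.
\<close>

section \<open>Derivations\<close>

text \<open>
  The three partial derivatives are treated uniformly as derivations, so that the gradient
  needs to be computed only once.
\<close>

definition derivation :: "('a::comm_ring_1 \<Rightarrow> 'a) \<Rightarrow> bool"
  where "derivation D \<longleftrightarrow>
    (\<forall>a b. D (a + b) = D a + D b) \<and> (\<forall>a b. D (a * b) = a * D b + D a * b)"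

lemma derivation_add: "derivation D \<Longrightarrow> D (a + b) = D a + D b"
  and derivation_mult: "derivation D \<Longrightarrow> D (a * b) = a * D b + D a * b"
  by (simp_all add: derivation_def)

lemma derivation_0: "derivation D \<Longrightarrow> D 0 = 0"
  using derivation_add[of D 0 0] by simp

lemma derivation_1: "derivation D \<Longrightarrow> D 1 = 0"
  using derivation_mult[of D 1 1] by simp

lemma derivation_diff: "derivation D \<Longrightarrow> D (a - b) = D a - D b"
  using derivation_add[of D "a - b" b] by (simp add: algebra_simps)

lemma derivation_sum: "derivation D \<Longrightarrow> D (sum f S) = (\<Sum>i\<in>S. D (f i))"
  by (induction S rule: infinite_finite_induct) (simp_all add: derivation_0 derivation_add)

lemma derivation_power:
  assumes "derivation D"
  shows "D (a ^ n) = of_nat n * a ^ (n - 1) * D a"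
proof (induction n)
  case 0
  show ?case by (simp add: derivation_1 assms)
next
  case (Suc n)
  have "of_nat n * a ^ n = a * (of_nat n * a ^ (n - 1))"
    by (cases n) (simp_all add: mult_ac)
  with Suc show ?case
    by (simp add: derivation_mult[OF assms] algebra_simps del: of_nat_Suc)
      (simp add: algebra_simps)
qed

lemma derivation_power_eq_0:
  assumes "derivation D" and "of_nat n = (0 :: 'a::comm_ring_1)"
  shows "D ((a :: 'a) ^ n) = 0"
  using assms by (simp add: derivation_power)

lemma derivation_pderiv: "derivation (pderiv :: 'a::idom poly \<Rightarrow> 'a poly)"
  by (simp add: derivation_def pderiv_add pderiv_mult mult.commute)

lemma derivation_map_poly:
  assumes "derivation D"
  shows "derivation (map_poly D)"
  unfolding derivation_def
  by (auto simp: poly_eq_iff coeff_map_poly coeff_mult derivation_0 derivation_add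
      derivation_mult derivation_sum assms sum.distrib)

lemma derivation_partials: "derivation dX" "derivation dY" "derivation dZ"
  by (simp_all add: dX_def dY_def dZ_def derivation_map_poly derivation_pderiv)

lemma partials_var:
  "dX varX = 1" "dX varY = 0" "dX varZ = 0"
  "dY varX = 0" "dY varY = 1" "dY varZ = 0"
  "dZ varX = 0" "dZ varY = 0" "dZ varZ = 1"
  by (simp_all add: dX_def dY_def dZ_def varX_def varY_def varZ_def map_poly_pCons
      pderiv_pCons one_pCons)

section \<open>The gradient at rational points\<close>

lemma eval3_hom:
  "eval3 0 v = 0" "eval3 1 v = 1" "eval3 (f + g) v = eval3 f v + eval3 g v"
  "eval3 (f - g) v = eval3 f v - eval3 g v" "eval3 (f * g) v = eval3 f v * eval3 g v"
  "eval3 (f ^ n) v = eval3 f v ^ n"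
  by (cases v; simp)+

lemma eval3_var:
  "eval3 varX (a, b, c) = a" "eval3 varY (a, b, c) = b" "eval3 varZ (a, b, c) = c"
  "eval3 (const3 k) (a, b, c) = k"
  by (simp_all add: varX_def varY_def varZ_def const3_def)

lemma of_nat_card_eq_0: "(of_nat CARD('a) :: 'a::finite_field) = 0"
proof -
  \<comment> \<open>Translation by \<open>1\<close> permutes the field, so it does not change the sum of all elements.\<close>
  have "(\<Sum>a\<in>UNIV. a + 1) = (\<Sum>a\<in>UNIV. a :: 'a)"
    by (rule sum.reindex_bij_witness[of _ "\<lambda>a. a - 1" "\<lambda>a. a + 1"]) simp_all
  thus ?thesis by (simp add: sum.distrib)
qed

lemma of_nat_card_poly3_eq_0: "(of_nat CARD('a) :: 'a::finite_field poly3) = 0"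
  by (simp add: of_nat_poly of_nat_card_eq_0)

text \<open>
  The summands in which \<open>D\<close> hits \<open>x\<^sup>r\<close>, \<open>y\<^sup>r\<close> or \<open>z\<^sup>r + k x\<^sup>r\<close> carry a factor of the form
  \<open>a\<^sup>q b - a b\<^sup>q\<close> and thus vanish; in the others only the factors without
  exponent \<open>q\<close> are differentiated, and \<open>a\<^sup>q = a\<close> then removes the Frobenius powers.
\<close>

lemma eval3_derivation_curve_C:
  fixes k :: "'a::finite_field"
  assumes D: "derivation D"
  shows "eval3 (D (curve_C (CARD('a)) k r)) (x, y, z) =
    x ^ r * (x * eval3 (D varY) (x, y, z) - y * eval3 (D varX) (x, y, z))
    + y ^ r * (y * eval3 (D varZ) (x, y, z) - z * eval3 (D varY) (x, y, z))
    + (z ^ r + k * x ^ r) * (z * eval3 (D varX) (x, y, z) - x * eval3 (D varZ) (x, y, z))"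
proof -
  note frobenius = derivation_power_eq_0[OF D of_nat_card_poly3_eq_0]
  show ?thesis
    by (simp add: curve_C_def derivation_add[OF D] derivation_diff[OF D] derivation_mult[OF D]
        frobenius eval3_hom eval3_var finite_field_power_card_eq_same mult.commute
        del: eval3.simps)
qed

lemma singular_iff_gradient_zero:
  fixes k :: "'a::finite_field"
  assumes "P \<in> proj_plane" and "r \<ge> 2"
  shows "singular_at (curve_C (CARD('a)) k r) P \<longleftrightarrow>
    (\<forall>(x, y, z)\<in>P. x ^ (r + 1) = y ^ r * z \<and> y ^ (r + 1) = (z ^ r + k * x ^ r) * x \<and>
       (z ^ r + k * x ^ r) * z = x ^ r * y)"
proof -
  have "vanishes_at (curve_C (CARD('a)) k r) P"
    using plane_filling_curve_C[OF assms(2), of k] assms(1)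
    by (auto simp: plane_filling_def rational_points_def)
  thus ?thesis
    unfolding singular_at_def vanishes_at_def
    by (auto simp: eval3_derivation_curve_C[OF derivation_partials(1)]
        eval3_derivation_curve_C[OF derivation_partials(2)]
        eval3_derivation_curve_C[OF derivation_partials(3)]
        partials_var eval3_hom mult.commute simp del: eval3.simps)
qed

section \<open>Zeros of the gradient\<close>

lemma gradient_zero_imp_root:
  fixes x y z k :: "'a::field"
  assumes nz: "(x, y, z) \<noteq> (0, 0, 0)" and "r > 0"
    and 1: "x ^ (r + 1) = y ^ r * z"
    and 2: "y ^ (r + 1) = (z ^ r + k * x ^ r) * x"
    and 3: "(z ^ r + k * x ^ r) * z = x ^ r * y"
  shows "(x / y) ^ (r\<^sup>2 + r + 1) + k * (x / y) ^ (r + 1) = 1"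
proof -
  have "y \<noteq> 0"
  proof
    assume "y = 0"
    with 1 \<open>r > 0\<close> have "x ^ (r + 1) = 0" by (simp only: zero_power mult_zero_left)
    hence "x = 0" by (rule power_eq_0_iff[THEN iffD1, THEN conjunct1])
    with 3 \<open>y = 0\<close> \<open>r > 0\<close> have "z = 0" by (simp add: zero_power)
    with nz \<open>x = 0\<close> \<open>y = 0\<close> show False by simp
  qed
  define t s where "t = x / y" and "s = z / y"
  have x: "x = t * y" and z: "z = s * y"
    using \<open>y \<noteq> 0\<close> by (simp_all add: t_def s_def)
  have "t ^ (r + 1) * y ^ (r + 1) = s * y ^ (r + 1)"
    using 1 by (simp add: x z power_mult_distrib mult_ac)
  hence s: "s = t ^ (r + 1)"
    using \<open>y \<noteq> 0\<close> by simp
  have "(z ^ r + k * x ^ r) * x = (s ^ r + k * t ^ r) * t * y ^ (r + 1)"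
    by (simp add: x z power_mult_distrib algebra_simps)
  with 2 have "(s ^ r + k * t ^ r) * t = 1"
    using \<open>y \<noteq> 0\<close> by simp
  moreover have "s ^ r * t = t ^ (r\<^sup>2 + r + 1)"
    by (simp add: s power2_eq_square power_add power_mult power_mult_distrib mult_ac)
  ultimately show ?thesis
    unfolding t_def[symmetric]
    by (simp only: distrib_right power_add power_one_right mult.assoc)
qed

text \<open>
  The scaling factor \<open>c\<close> runs through all coordinate vectors of the point
  \<open>[t : 1 : t\<^bsup>r + 1\<^esup>]\<close>, because vanishing at a point refers to each of them.
\<close>

lemma root_imp_gradient_zero:
  fixes t c k :: "'a::field"
  assumes "t ^ (r\<^sup>2 + r + 1) + k * t ^ (r + 1) = 1"
    and x: "x = c * t" and y: "y = c" and z: "z = c * t ^ (r + 1)"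
  shows "x ^ (r + 1) = y ^ r * z" and "y ^ (r + 1) = (z ^ r + k * x ^ r) * x"
    and "(z ^ r + k * x ^ r) * z = x ^ r * y"
proof -
  have "(t ^ (r + 1)) ^ r * t = t ^ (r\<^sup>2 + r + 1)"
    by (simp add: power2_eq_square power_add power_mult power_mult_distrib mult_ac)
  hence "((t ^ (r + 1)) ^ r + k * t ^ r) * t = 1"
    using assms(1) by (simp only: distrib_right power_add power_one_right mult.assoc)
  moreover have "z ^ r + k * x ^ r = c ^ r * ((t ^ (r + 1)) ^ r + k * t ^ r)"
    unfolding x z power_mult_distrib by (simp only: algebra_simps)
  ultimately have w: "(z ^ r + k * x ^ r) * t = c ^ r"
    by (simp only: mult.assoc mult_1_right)
  show "x ^ (r + 1) = y ^ r * z"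
    by (simp add: x y z power_mult_distrib)
  have "(z ^ r + k * x ^ r) * x = c * ((z ^ r + k * x ^ r) * t)"
    by (simp only: x mult_ac)
  thus "y ^ (r + 1) = (z ^ r + k * x ^ r) * x"
    by (simp only: w) (simp only: y power_add power_one_right mult_ac)
  have "(z ^ r + k * x ^ r) * z = c * t ^ r * ((z ^ r + k * x ^ r) * t)"
    by (subst (2) z) (simp only: power_add power_one_right mult_ac)
  also have "\<dots> = x ^ r * y"
    by (simp only: w) (simp only: x y power_mult_distrib mult_ac)
  finally show "(z ^ r + k * x ^ r) * z = x ^ r * y" .
qed

lemma proj_plane_nonzero_coordinates:
  assumes "P \<in> proj_plane"
  obtains x y z where "(x, y, z) \<in> P" and "(x, y, z) \<noteq> (0, 0, 0)"
proof -
  obtain v where v: "v \<noteq> (0, 0, 0)" and P: "P = proj_rel `` {v}"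
    using assms unfolding proj_plane_def by (blast elim: quotientE)
  obtain x y z where xyz: "v = (x, y, z)" by (cases v)
  have "(v, v) \<in> proj_rel"
    using v unfolding proj_rel_def xyz by (auto intro!: exI[of _ "1 :: 'a"])
  thus thesis
    using that[of x y z] v P xyz by simp
qed

theorem theorem1p8:
  fixes k :: "'a::finite_field" and q r :: nat
  assumes "q = CARD('a)" and "r \<ge> 2"
  shows "(\<forall>P \<in> proj_plane. smooth_at (curve_C q k r) P) \<longleftrightarrow>
         \<not> (\<exists>t :: 'a. poly (monom 1 (r^2 + r + 1) + monom k (r + 1) - 1) t = 0)"
proof -
  let ?C = "curve_C (CARD('a)) k r"
  have "smooth_at ?C P \<longleftrightarrow> \<not> singular_at ?C P" if "P \<in> proj_plane" for P
    using plane_filling_curve_C[OF assms(2), of k] that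
    by (auto simp: plane_filling_def rational_points_def smooth_at_def)
  moreover have "(\<exists>P\<in>proj_plane. singular_at ?C P) \<longleftrightarrow>
      (\<exists>t. t ^ (r\<^sup>2 + r + 1) + k * t ^ (r + 1) = 1)"
  proof
    assume "\<exists>P\<in>proj_plane. singular_at ?C P"
    then obtain P where P: "P \<in> proj_plane" "singular_at ?C P" by blast
    obtain x y z where "(x, y, z) \<in> P" and nz: "(x, y, z) \<noteq> (0, 0, 0)"
      using proj_plane_nonzero_coordinates[OF P(1)] .
    with P have "x ^ (r + 1) = y ^ r * z" "y ^ (r + 1) = (z ^ r + k * x ^ r) * x"
        "(z ^ r + k * x ^ r) * z = x ^ r * y"
      using singular_iff_gradient_zero[OF P(1) assms(2), of k] by blast+
    with nz show "\<exists>t. t ^ (r\<^sup>2 + r + 1) + k * t ^ (r + 1) = 1"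
      using gradient_zero_imp_root assms(2) by (metis not_numeral_le_zero gr0I)
  next
    assume "\<exists>t. t ^ (r\<^sup>2 + r + 1) + k * t ^ (r + 1) = 1"
    then obtain t where t: "t ^ (r\<^sup>2 + r + 1) + k * t ^ (r + 1) = 1" ..
    define P where "P = proj_rel `` {(t, 1, t ^ (r + 1))}"
    have P: "P \<in> proj_plane"
      unfolding proj_plane_def P_def by (rule quotientI) simp
    have "singular_at ?C P"
      unfolding singular_iff_gradient_zero[OF P assms(2)]
    proof clarify
      fix x y z
      assume "(x, y, z) \<in> P"
      then obtain c where "x = c * t" "y = c" "z = c * t ^ (r + 1)"
        unfolding P_def proj_rel_def by auto
      note root_imp_gradient_zero[OF t this]
      thus "x ^ (r + 1) = y ^ r * z \<and> y ^ (r + 1) = (z ^ r + k * x ^ r) * x \<and>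
          (z ^ r + k * x ^ r) * z = x ^ r * y"
        by (intro conjI)
    qed
    with P show "\<exists>P\<in>proj_plane. singular_at ?C P" by blast
  qed
  ultimately show ?thesis
    by (auto simp: assms(1) poly_monom)
qed

end
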